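(* Let $(\mathbf{X},\mathbf{T})$ be a nonautonomous dynamical system, let $E\subset X_0$ be a Borel set, let $s>0$, and let $\mu$ be a Borel probability measure on $X_0$. (1) If $\overline{h}_{\mu}(\mathbf{T},x)\le s$ for all $x\in E$, then $h_{\mathrm{top}}^{\mathrm{P}}(\mathbf{T},E)\le s$. (2) If $\overline{h}_{\mu}(\mathbf{T},x)\ge s$ for all $x\in E$ and $\mu(E)>0$, then $h_{\mathrm{top}}^{\mathrm{P}}(\mathbf{T},E)\ge s$.
   Context: A nonautonomous dynamical system (NDS) $(\mathbf{X},\mathbf{T})$ consists of a sequence $\mathbf{X}=\{X_k\}_{k=0}^\infty$ of compact metric spaces $(X_k,d_k)$ and a sequence $\mathbf{T}=\{T_k\}_{k=0}^\infty$ of continuous maps $T_k:X_k\to X_{k+1}$. Put $\mathbf{T}^0=\mathrm{id}_{X_0}$ and $\mathbf{T}^j=T_{j-1}\circ\cdots\circ T_0:X_0\to X_j$. For $n\ge1$ and $x,y\in X_0$ let $d_n^{\mathbf{T}}(x,y)=\max_{0\le j\le n-1}d_j(\mathbf{T}^jx,\mathbf{T}^jy)$, and for $\varepsilon>0$ let $B_n^{\mathbf{T}}(x,\varepsilon)$, $\overline{B}_n^{\mathbf{T}}(x,\varepsilon)$ be the sets of $y\in X_0$ with $d_n^{\mathbf{T}}(x,y)<\varepsilon$, respectively $\le\varepsilon$. Measure-theoretic upper local entropy: $\overline{h}_\mu(\mathbf{T},x)=\lim_{\varepsilon\to0}\limsup_{n\to\infty}\frac{-\log\mu(B_n^{\mathbf{T}}(x,\varepsilon))}{n}$,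 with $\log0=-\infty$. Packing entropy: for $Z\subset X_0$, an $(N,\varepsilon)$-packing of $Z$ is a family of pairwise disjoint closed Bowen balls $\{\overline{B}_{n_i}^{\mathbf{T}}(x_i,\varepsilon)\}_i$ with $x_i\in Z$ and integers $n_i\ge N$. For $s\in\mathbb{R}$, $N,\varepsilon>0$ let $\mathscr{P}_{N,\varepsilon}^{s}(\mathbf{T},\mathbf{0},Z)=\sup\sum_i\exp(-n_is)$ over all countable (finite or infinite) $(N,\varepsilon)$-packings of $Z$; $\mathscr{P}_{\infty,\varepsilon}^{s}=\lim_{N\to\infty}\mathscr{P}_{N,\varepsilon}^{s}$; $\mathscr{P}_{\varepsilon}^{s}(\mathbf{T},\mathbf{0},Z)=\inf\{\sum_{i=1}^\infty\mathscr{P}_{\infty,\varepsilon}^{s}(\mathbf{T},\mathbf{0},Z_i):\bigcup_iZ_i\supseteq Z\}$; $h_{\mathrm{top}}^{\mathrm{P}}(\mathbf{T},Z)=\lim_{\varepsilon\to0}\inf\{s:\mathscr{P}_{\varepsilon}^{s}(\mathbf{T},\mathbf{0},Z)=0\}$ (monotone limit). *)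

theory Defs
  imports "HOL-Probability.Probability"
begin

text \<open>
  A nonautonomous dynamical system.  All spaces live in one carrier type, but each has its own
  point set \<^term>\<open>mspace (X k)\<close> and its own metric \<^term>\<open>mdist (X k)\<close>; a sequence of unrelated
  metric spaces is accommodated by taking the carrier to be (for instance) their disjoint union.
  The values of \<^term>\<open>T k\<close> outside \<^term>\<open>mspace (X k)\<close> never matter.
\<close>

locale nonautonomous_ds =
  fixes X :: "nat \<Rightarrow> 'a metric" and T :: "nat \<Rightarrow> 'a \<Rightarrow> 'a"
  assumes compact: "\<And>k. compact_space (mtopology_of (X k))"
    and continuous:
      "\<And>k. continuous_map (mtopology_of (X k)) (mtopology_of (X (Suc k))) (T k)"

definition metric_borel :: "'a metric \<Rightarrow> 'a measure" where
  "metric_borel M = sigma (mspace M) {U. openin (mtopology_of M) U}"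

primrec orbit_map :: "(nat \<Rightarrow> 'a \<Rightarrow> 'a) \<Rightarrow> nat \<Rightarrow> 'a \<Rightarrow> 'a" where
  "orbit_map T 0 = id"
| "orbit_map T (Suc j) = T j \<circ> orbit_map T j"

text \<open>Only meaningful for \<open>n \<ge> 1\<close>; the case \<open>n = 0\<close> is a maximum over the empty set.\<close>

definition bowen_dist ::
    "(nat \<Rightarrow> 'a metric) \<Rightarrow> (nat \<Rightarrow> 'a \<Rightarrow> 'a) \<Rightarrow> nat \<Rightarrow> 'a \<Rightarrow> 'a \<Rightarrow> real" where
  "bowen_dist X T n x y = Max ((\<lambda>j. mdist (X j) (orbit_map T j x) (orbit_map T j y)) ` {..<n})"

definition bowen_ball ::
    "(nat \<Rightarrow> 'a metric) \<Rightarrow> (nat \<Rightarrow> 'a \<Rightarrow> 'a) \<Rightarrow> nat \<Rightarrow> 'a \<Rightarrow> real \<Rightarrow> 'a set" where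
  "bowen_ball X T n x \<epsilon> = {y \<in> mspace (X 0). bowen_dist X T n x y < \<epsilon>}"

definition bowen_cball ::
    "(nat \<Rightarrow> 'a metric) \<Rightarrow> (nat \<Rightarrow> 'a \<Rightarrow> 'a) \<Rightarrow> nat \<Rightarrow> 'a \<Rightarrow> real \<Rightarrow> 'a set" where
  "bowen_cball X T n x \<epsilon> = {y \<in> mspace (X 0). bowen_dist X T n x y \<le> \<epsilon>}"

definition log_ereal :: "real \<Rightarrow> ereal" where
  "log_ereal p = (if p = 0 then -\<infinity> else ereal (ln p))"

definition upper_local_entropy ::
    "(nat \<Rightarrow> 'a metric) \<Rightarrow> (nat \<Rightarrow> 'a \<Rightarrow> 'a) \<Rightarrow> 'a measure \<Rightarrow> 'a \<Rightarrow> ereal" where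
  "upper_local_entropy X T \<mu> x =
     Lim (at_right 0)
       (\<lambda>\<epsilon>. limsup (\<lambda>n. (- log_ereal (measure \<mu> (bowen_ball X T n x \<epsilon>))) / ereal (real n)))"

text \<open>
  A packing is recorded as the countable set of its indices \<open>(x\<^sub>i, n\<^sub>i)\<close>.  No generality is lost
  compared with indexed families: for \<open>n \<ge> 1\<close> and \<open>\<epsilon> > 0\<close> a ball contains its centre, so in a
  pairwise disjoint family no pair occurs twice.
\<close>

definition bowen_packing ::
    "(nat \<Rightarrow> 'a metric) \<Rightarrow> (nat \<Rightarrow> 'a \<Rightarrow> 'a) \<Rightarrow> nat \<Rightarrow> real \<Rightarrow> 'a set \<Rightarrow> ('a \<times> nat) set \<Rightarrow> bool" where
  "bowen_packing X T N \<epsilon> Z P \<longleftrightarrow>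
     countable P \<and> P \<subseteq> Z \<times> {N..} \<and> disjoint_family_on (\<lambda>(x, n). bowen_cball X T n x \<epsilon>) P"

definition packing_sum ::
    "(nat \<Rightarrow> 'a metric) \<Rightarrow> (nat \<Rightarrow> 'a \<Rightarrow> 'a) \<Rightarrow> nat \<Rightarrow> real \<Rightarrow> real \<Rightarrow> 'a set \<Rightarrow> ennreal" where
  "packing_sum X T N \<epsilon> s Z =
     (SUP P \<in> {P. bowen_packing X T N \<epsilon> Z P}. \<Sum>\<^sub>\<infinity>(x, n)\<in>P. ennreal (exp (- real n * s)))"

definition packing_premeasure ::
    "(nat \<Rightarrow> 'a metric) \<Rightarrow> (nat \<Rightarrow> 'a \<Rightarrow> 'a) \<Rightarrow> real \<Rightarrow> real \<Rightarrow> 'a set \<Rightarrow> ennreal" where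
  "packing_premeasure X T \<epsilon> s Z = lim (\<lambda>N. packing_sum X T N \<epsilon> s Z)"

definition packing_outer_measure ::
    "(nat \<Rightarrow> 'a metric) \<Rightarrow> (nat \<Rightarrow> 'a \<Rightarrow> 'a) \<Rightarrow> real \<Rightarrow> real \<Rightarrow> 'a set \<Rightarrow> ennreal" where
  "packing_outer_measure X T \<epsilon> s Z =
     (INF W \<in> {W :: nat \<Rightarrow> 'a set. (\<forall>i. W i \<subseteq> mspace (X 0)) \<and> Z \<subseteq> (\<Union>i. W i)}.
        \<Sum>i. packing_premeasure X T \<epsilon> s (W i))"

text \<open>
  The infimum is taken in the extended reals over real exponents, so it is \<open>\<infinity>\<close> if no exponent
  qualifies and \<open>-\<infinity>\<close> for the empty set.
\<close>

definition packing_entropy ::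
    "(nat \<Rightarrow> 'a metric) \<Rightarrow> (nat \<Rightarrow> 'a \<Rightarrow> 'a) \<Rightarrow> 'a set \<Rightarrow> ereal" where
  "packing_entropy X T Z =
     Lim (at_right 0) (\<lambda>\<epsilon>. INF s \<in> {s :: real. packing_outer_measure X T \<epsilon> s Z = 0}. ereal s)"

end

theory Submission
  imports Defs
begin

text \<open>
  Both limits \<open>\<epsilon> \<rightarrow> 0\<close> are suprema.  For (1), stratify \<open>E\<close> by the time \<open>N\<close> from which
  \<open>\<mu>(B\<^sub>n(x, \<epsilon>)) > exp(-n t)\<close>, where \<open>s < t < u\<close>: a packing of a stratum consists of disjoint balls
  of total mass at most 1, so its weight with exponent \<open>u\<close> is at most \<open>exp(-M (u - t))\<close> once all
  times are at least \<open>M\<close>, and this tends to 0.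

  For (2), let \<open>u < t < s\<close>.  At a suitable scale \<open>r\<close>, every point of a set \<open>A \<subseteq> E\<close> of positive outer
  measure satisfies \<open>\<mu>(B\<^sub>n(x, r)) < exp(-n t)\<close> for infinitely many \<open>n\<close>.  For a fixed \<open>n\<close> choose a
  maximal disjoint family of closed \<open>\<epsilon>\<close>-balls centred at such points, where \<open>2 \<epsilon> < r\<close>; the
  \<open>r\<close>-balls with the same centres cover these points.  Summing over \<open>n \<ge> N\<close> bounds the outer
  measure of \<open>A\<close> by the packing premeasure times \<open>\<Sum>\<^sub>n exp(-n (t - u)) < \<infinity>\<close>, and the same bound on
  the pieces of a cover shows that the packing outer measure of \<open>E\<close> is positive.
\<close>

section \<open>Monotone limits, outer measure and exponential rates\<close>

text \<open>Values rise as the scale shrinks, so a value above \<open>a\<close> at one scale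
  persists at all smaller ones. This turns both entropies into suprema, to be bounded one scale at a
  time.\<close>

lemma Lim_at_right_decreasing:
  fixes f :: "real \<Rightarrow> 'b::{complete_linorder, linorder_topology}"
  assumes anti: "\<And>a b. 0 < a \<Longrightarrow> a \<le> b \<Longrightarrow> f b \<le> f a"
  shows "Lim (at_right 0) f = (SUP \<epsilon>\<in>{0<..}. f \<epsilon>)"
proof (rule tendsto_Lim)
  show "(f \<longlongrightarrow> (SUP \<epsilon>\<in>{0<..}. f \<epsilon>)) (at_right 0)"
  proof (rule order_tendstoI)
    fix a assume "a < (SUP \<epsilon>\<in>{0<..}. f \<epsilon>)"
    then obtain \<epsilon> where e: "\<epsilon> > 0" "a < f \<epsilon>"
      by (auto simp: less_SUP_iff)
    have "eventually (\<lambda>x. x \<in> {0<..<\<epsilon>}) (at_right 0)"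
      using e(1) by (rule eventually_at_right_real)
    then show "eventually (\<lambda>x. a < f x) (at_right 0)"
      by (rule eventually_mono) (use e(2) anti in \<open>auto elim: less_le_trans\<close>)
  next
    fix a assume "(SUP \<epsilon>\<in>{0<..}. f \<epsilon>) < a"
    moreover have "f x \<le> (SUP \<epsilon>\<in>{0<..}. f \<epsilon>)" if "x > 0" for x
      using that by (intro SUP_upper) auto
    ultimately show "eventually (\<lambda>x. f x < a) (at_right 0)"
      by (intro eventually_at_rightI[of 0 1]) (auto intro: le_less_trans)
  qed
qed simp

text \<open>Measurable hulls of equal outer measure reduce this to subadditivity of
  \<open>emeasure\<close>. It serves for sets of points with small balls, whose measurability is
  left open.\<close>

lemma outer_measure_of_UN_le:
  assumes A: "\<And>n::nat. A n \<subseteq> space M"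
  shows "outer_measure_of M (\<Union>n. A n) \<le> (\<Sum>n. outer_measure_of M (A n))"
proof -
  obtain B where B: "\<And>n. B n \<in> sets M" "\<And>n. A n \<subseteq> B n"
      "\<And>n. outer_measure_of M (A n) = emeasure M (B n)"
    using outer_measure_of_attain[OF A] by metis
  have "outer_measure_of M (\<Union>n. A n) \<le> outer_measure_of M (\<Union>n. B n)"
    using B(2) by (intro outer_measure_of_mono) blast
  also have "\<dots> = emeasure M (\<Union>n. B n)"
    using B(1) by (intro outer_measure_of_eq) auto
  also have "\<dots> \<le> (\<Sum>n. emeasure M (B n))"
    using B(1) by (intro emeasure_subadditive_countably) auto
  finally show ?thesis by (simp add: B(3))
qed

lemma disjoint_family_on_shrink:
  assumes "disjoint_family_on B J" "I \<subseteq> J" "\<And>i. i \<in> I \<Longrightarrow> A i \<subseteq> B i"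
  shows "disjoint_family_on A I"
  unfolding disjoint_family_on_def
proof (intro ballI impI)
  fix i j assume "i \<in> I" "j \<in> I" "i \<noteq> j"
  then have "A i \<subseteq> B i" "A j \<subseteq> B j" "B i \<inter> B j = {}"
    using assms by (auto dest: disjoint_family_onD)
  then show "A i \<inter> A j = {}" by blast
qed

lemma suminf_exp_less_top:
  assumes "u < (t::real)"
  shows "(\<Sum>n. ennreal (exp (- real n * (t - u)))) < \<top>"
proof -
  have "summable (\<lambda>n. exp (- (t - u)) ^ n)"
    using assms by (intro summable_geometric) simp
  then have "summable (\<lambda>n. exp (- real n * (t - u)))"
    by (simp add: algebra_simps flip: exp_of_nat_mult)
  then show ?thesis
    by (simp add: suminf_ennreal2)
qed

text \<open>Translates rates into ball measures. For \<open>p = 0\<close> the rate is \<infinity>,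
  so both sides fail.\<close>

lemma neg_log_ereal_div_less_iff:
  assumes "0 \<le> p" "n > 0"
  shows "- log_ereal p / ereal (real n) < ereal t \<longleftrightarrow> exp (- real n * t) < p"
proof (cases "p = 0")
  case False
  then have "p > 0" using assms by simp
  then have "exp (- real n * t) < p \<longleftrightarrow> - real n * t < ln p"
    by (metis exp_less_cancel_iff exp_ln)
  also have "\<dots> \<longleftrightarrow> - ln p / real n < t"
    using assms(2) by (auto simp: field_simps)
  finally show ?thesis
    using False assms(2) by (simp add: log_ereal_def)
qed (use assms in \<open>simp add: log_ereal_def\<close>)

text \<open>Counterpart for rates bounded below: for \<open>p = 0\<close> the rate is \<infinity>
  and both sides hold.\<close>

lemma less_neg_log_ereal_div_iff:
  assumes "0 \<le> p" "n > 0"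
  shows "ereal t < - log_ereal p / ereal (real n) \<longleftrightarrow> p < exp (- real n * t)"
proof (cases "p = 0")
  case False
  then have "p > 0" using assms by simp
  then have "p < exp (- real n * t) \<longleftrightarrow> ln p < - real n * t"
    by (metis exp_less_cancel_iff exp_ln)
  also have "\<dots> \<longleftrightarrow> t < - ln p / real n"
    using assms(2) by (auto simp: field_simps)
  finally show ?thesis
    using False assms(2) by (simp add: log_ereal_def)
qed (use assms in \<open>simp add: log_ereal_def\<close>)

lemma log_ereal_mono: "0 \<le> p \<Longrightarrow> p \<le> q \<Longrightarrow> log_ereal p \<le> log_ereal q"
  by (auto simp: log_ereal_def)

lemma
  shows space_metric_borel: "space (metric_borel M) = mspace M"
    and sets_metric_borelI: "openin (mtopology_of M) U \<Longrightarrow> U \<in> sets (metric_borel M)"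
proof -
  have *: "{U. openin (mtopology_of M) U} \<subseteq> Pow (mspace M)"
    using openin_subset[of "mtopology_of M"] by auto
  show "space (metric_borel M) = mspace M"
    by (simp add: metric_borel_def space_measure_of[OF *])
  show "openin (mtopology_of M) U \<Longrightarrow> U \<in> sets (metric_borel M)"
    by (simp add: metric_borel_def sets_measure_of[OF *])
qed

section \<open>Entropies at a fixed scale; monotonicity of packing quantities\<close>

text \<open>The term \<open>n = 0\<close>, with its maximum over the empty set, does not influence
  the limsup.\<close>

definition local_entropy_at_scale ::
    "(nat \<Rightarrow> 'a metric) \<Rightarrow> (nat \<Rightarrow> 'a \<Rightarrow> 'a) \<Rightarrow> 'a measure \<Rightarrow> 'a \<Rightarrow> real \<Rightarrow> ereal" where
  "local_entropy_at_scale X T \<mu> x \<epsilon> =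
     limsup (\<lambda>n. - log_ereal (measure \<mu> (bowen_ball X T n x \<epsilon>)) / ereal (real n))"

definition packing_entropy_at_scale ::
    "(nat \<Rightarrow> 'a metric) \<Rightarrow> (nat \<Rightarrow> 'a \<Rightarrow> 'a) \<Rightarrow> 'a set \<Rightarrow> real \<Rightarrow> ereal" where
  "packing_entropy_at_scale X T Z \<epsilon> =
     (INF s \<in> {s :: real. packing_outer_measure X T \<epsilon> s Z = 0}. ereal s)"

lemma bowen_dist_less_iff:
  "n > 0 \<Longrightarrow> bowen_dist X T n x y < \<epsilon> \<longleftrightarrow>
     (\<forall>j<n. mdist (X j) (orbit_map T j x) (orbit_map T j y) < \<epsilon>)"
  unfolding bowen_dist_def by (subst Max_less_iff) auto

lemma bowen_dist_le_iff:
  "n > 0 \<Longrightarrow> bowen_dist X T n x y \<le> \<epsilon> \<longleftrightarrow>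
     (\<forall>j<n. mdist (X j) (orbit_map T j x) (orbit_map T j y) \<le> \<epsilon>)"
  unfolding bowen_dist_def by (subst Max_le_iff) auto

lemma bowen_dist_commute: "bowen_dist X T n x y = bowen_dist X T n y x"
  by (simp add: bowen_dist_def mdist_commute)

lemma bowen_cball_mono: "a \<le> b \<Longrightarrow> bowen_cball X T n x a \<subseteq> bowen_cball X T n x b"
  by (auto simp: bowen_cball_def)

text \<open>Raising \<open>N\<close> leaves fewer packings to take the supremum over.\<close>

lemma decseq_packing_sum: "decseq (\<lambda>N. packing_sum X T N \<epsilon> s Z)"
  unfolding packing_sum_def decseq_def bowen_packing_def
  by (intro allI impI SUP_subset_mono) auto

lemma packing_premeasure_eq_INF:
  "packing_premeasure X T \<epsilon> s Z = (INF N. packing_sum X T N \<epsilon> s Z)"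
  unfolding packing_premeasure_def
  by (intro limI LIMSEQ_INF decseq_packing_sum)

lemma packing_sum_mono_set: "Z \<subseteq> W \<Longrightarrow> packing_sum X T N \<epsilon> s Z \<le> packing_sum X T N \<epsilon> s W"
  unfolding packing_sum_def bowen_packing_def
  by (intro SUP_subset_mono) auto

text \<open>Shrinking the closed balls preserves disjointness, so a packing at scale
  \<open>b\<close> is one at scale \<open>a\<close> with the same indices and the same sum.\<close>

lemma packing_sum_antimono_scale:
  assumes "a \<le> b"
  shows "packing_sum X T N b s Z \<le> packing_sum X T N a s Z"
proof -
  have "bowen_packing X T N a Z P" if "bowen_packing X T N b Z P" for P
    using that unfolding bowen_packing_def
    by (auto elim!: disjoint_family_on_shrink intro!: bowen_cball_mono[OF assms, THEN subsetD])
  then show ?thesis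
    unfolding packing_sum_def by (intro SUP_subset_mono) auto
qed

lemma packing_outer_measure_antimono_scale:
  "a \<le> b \<Longrightarrow> packing_outer_measure X T b s Z \<le> packing_outer_measure X T a s Z"
  unfolding packing_outer_measure_def packing_premeasure_eq_INF
  by (intro INF_mono' suminf_le packing_sum_antimono_scale INF_superset_mono) auto

text \<open>A smaller scale has a larger packing outer measure, hence fewer exponents that
  annihilate it and a larger infimum over them.\<close>

lemma packing_entropy_eq_SUP:
  "packing_entropy X T Z = (SUP \<epsilon>\<in>{0<..}. packing_entropy_at_scale X T Z \<epsilon>)"
proof -
  have "packing_entropy_at_scale X T Z b \<le> packing_entropy_at_scale X T Z a" if "a \<le> b" for a b
    unfolding packing_entropy_at_scale_def
    using packing_outer_measure_antimono_scale[OF that, of X T _ Z]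
    by (intro INF_superset_mono) (auto simp flip: le_zero_eq intro: order_trans)
  then have "Lim (at_right 0) (packing_entropy_at_scale X T Z) =
      (SUP \<epsilon>\<in>{0<..}. packing_entropy_at_scale X T Z \<epsilon>)"
    by (intro Lim_at_right_decreasing)
  then show ?thesis
    by (simp add: packing_entropy_def packing_entropy_at_scale_def[abs_def])
qed

section \<open>Bowen balls: openness, compactness and maximal disjoint families\<close>

context nonautonomous_ds
begin

lemma continuous_map_orbit_map:
  "continuous_map (mtopology_of (X 0)) (mtopology_of (X j)) (orbit_map T j)"
proof (induction j)
  case 0 then show ?case by (simp add: id_def)
next
  case (Suc j)
  then show ?case using continuous_map_compose[OF Suc continuous[of j]] by (simp add: o_def)
qed

lemma orbit_map_in_mspace: "x \<in> mspace (X 0) \<Longrightarrow> orbit_map T j x \<in> mspace (X j)"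
  using continuous_map_orbit_map[of j] by (auto simp: continuous_map_def)

text \<open>The triangle inequality at each time \<open>j < n\<close>. The mixed form is made for
  closed balls that meet: their centres lie in an open ball of strictly larger radius.\<close>

lemma bowen_dist_triangle_less:
  assumes "n > 0" "x \<in> mspace (X 0)" "y \<in> mspace (X 0)" "z \<in> mspace (X 0)"
    and "bowen_dist X T n x y \<le> a" "bowen_dist X T n y z \<le> b" "a + b < c"
  shows "bowen_dist X T n x z < c"
  unfolding bowen_dist_less_iff[OF assms(1)]
proof (intro allI impI)
  fix j assume "j < n"
  then have "mdist (X j) (orbit_map T j x) (orbit_map T j y) \<le> a"
    "mdist (X j) (orbit_map T j y) (orbit_map T j z) \<le> b"
    using assms(5,6) by (auto simp: bowen_dist_le_iff[OF assms(1)])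
  moreover have "mdist (X j) (orbit_map T j x) (orbit_map T j z) \<le>
     mdist (X j) (orbit_map T j x) (orbit_map T j y) + mdist (X j) (orbit_map T j y) (orbit_map T j z)"
    using assms(2-4) by (intro mdist_triangle orbit_map_in_mspace)
  ultimately show "mdist (X j) (orbit_map T j x) (orbit_map T j z) < c"
    using assms(7) by linarith
qed

lemma centre_in_bowen_ball:
  assumes "n > 0" "\<epsilon> > 0" "x \<in> mspace (X 0)"
  shows "x \<in> bowen_ball X T n x \<epsilon>"
proof -
  have "mdist (X j) (orbit_map T j x) (orbit_map T j x) = 0" for j
    using mdist_zero[OF orbit_map_in_mspace orbit_map_in_mspace, of x x j] assms(3) by simp
  with assms show ?thesis
    by (simp add: bowen_ball_def bowen_dist_less_iff)
qed

text \<open>The ball is a finite intersection of preimages of open balls under the continuous orbit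
  maps.\<close>

lemma openin_bowen_ball:
  assumes "n > 0" "x \<in> mspace (X 0)"
  shows "openin (mtopology_of (X 0)) (bowen_ball X T n x \<epsilon>)"
proof -
  have "bowen_ball X T n x \<epsilon> =
      (\<Inter>j<n. {y \<in> topspace (mtopology_of (X 0)). orbit_map T j y \<in> mball_of (X j) (orbit_map T j x) \<epsilon>})"
    using assms by (auto simp: bowen_ball_def bowen_dist_less_iff orbit_map_in_mspace)
  moreover have "openin (mtopology_of (X j)) (mball_of (X j) p \<epsilon>)" for j p
    by (simp add: mball_of_def mtopology_of_def Metric_space.openin_mball)
  ultimately show ?thesis
    using assms(1) openin_continuous_map_preimage[OF continuous_map_orbit_map]
    by (simp only:) (intro openin_INT2; auto simp del: topspace_mtopology_of in_mball_of)
qed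

text \<open>Compactness bounds the size of disjoint families, so one of greatest cardinality exists.
  Adding a further point of \<open>G\<close> breaks disjointness, which puts that point within
  \<open>2 * \<epsilon> < r\<close> of a chosen centre.\<close>

lemma finite_maximal_disjoint_bowen_cballs:
  assumes n: "n > 0" and e: "\<epsilon> > 0" and G: "G \<subseteq> mspace (X 0)" and "2 * \<epsilon> < r"
  obtains F where "finite F" "F \<subseteq> G"
    "disjoint_family_on (\<lambda>x. bowen_cball X T n x \<epsilon>) F"
    "G \<subseteq> (\<Union>x\<in>F. bowen_ball X T n x r)"
proof -
  let ?C = "\<lambda>x. bowen_cball X T n x \<epsilon>"
  let ?B = "\<lambda>x. bowen_ball X T n x (\<epsilon> / 2)"
  have cover: "mspace (X 0) \<subseteq> \<Union> (?B ` mspace (X 0))"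
    using centre_in_bowen_ball[OF n, of "\<epsilon> / 2"] e by auto
  have "compactin (mtopology_of (X 0)) (mspace (X 0))"
    using compact[of 0] by (simp add: compact_space_def)
  then have "\<exists>\<F>. finite \<F> \<and> \<F> \<subseteq> ?B ` mspace (X 0) \<and> mspace (X 0) \<subseteq> \<Union>\<F>"
    by (rule compactinD[OF _ _ cover]) (auto intro: openin_bowen_ball[OF n])
  then obtain \<F> where \<F>: "finite \<F>" "\<F> \<subseteq> ?B ` mspace (X 0)" "mspace (X 0) \<subseteq> \<Union>\<F>"
    by (elim exE conjE)
  obtain K where K: "K \<subseteq> mspace (X 0)" "finite K" "\<F> = ?B ` K"
    using finite_subset_image[OF \<F>(1,2)] by (elim exE conjE)
  have K3: "mspace (X 0) \<subseteq> (\<Union>k\<in>K. ?B k)"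
    using \<F>(3) K(3) by simp
  let ?Q = "\<lambda>F. finite F \<and> F \<subseteq> G \<and> disjoint_family_on ?C F"
  have bound: "card F \<le> card K" if F: "?Q F" for F
  proof -
    obtain k where k: "\<And>x. x \<in> F \<Longrightarrow> k x \<in> K \<and> x \<in> ?B (k x)"
    proof -
      have "\<forall>x\<in>F. \<exists>k\<in>K. x \<in> ?B k"
        using F G K3 by blast
      from bchoice[OF this[unfolded Bex_def]] show thesis using that by blast
    qed
    \<comment> \<open>Two centres assigned to the same \<open>k\<close> would both have it in their
      closed \<epsilon>-balls, as covering balls have radius \<open>\<epsilon> / 2\<close>.\<close>
    have "inj_on k F"
    proof (rule inj_onI)
      fix x y assume xy: "x \<in> F" "y \<in> F" "k x = k y"
      have mem: "x \<in> mspace (X 0)" "y \<in> mspace (X 0)" "k x \<in> mspace (X 0)"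
        using xy F G k K(1) by auto
      have d: "bowen_dist X T n (k x) x < \<epsilon> / 2" "bowen_dist X T n (k x) y < \<epsilon> / 2"
        using k[OF xy(1)] k[OF xy(2)] xy(3) by (auto simp: bowen_ball_def)
      have "k x \<in> ?C x \<inter> ?C y"
        using d mem e by (auto simp: bowen_cball_def bowen_dist_commute[of X T n _ "k x"])
      then show "x = y"
        using F xy by (auto simp: disjoint_family_on_def)
    qed
    then show ?thesis
      using k K(2) by (intro card_inj_on_le[of k]) auto
  qed
  have "?Q {}" by (auto simp: disjoint_family_on_def)
  \<comment> \<open>The empty family is the initial candidate, and \<open>Suc (card K)\<close> is a
    strict bound on all cardinalities.\<close>
  then obtain F where F: "?Q F" and max: "\<And>F'. ?Q F' \<Longrightarrow> card F' \<le> card F"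
    using ex_has_greatest_nat[of ?Q "{}" card "Suc (card K)"] bound less_Suc_eq_le by metis
  have "G \<subseteq> (\<Union>x\<in>F. bowen_ball X T n x r)"
  proof
    fix y assume y: "y \<in> G"
    then have ym: "y \<in> mspace (X 0)" using G by auto
    show "y \<in> (\<Union>x\<in>F. bowen_ball X T n x r)"
    proof (cases "y \<in> F")
      case True
      then show ?thesis using centre_in_bowen_ball[OF n, of r y] ym e assms(4) by auto
    next
      case False
      have "\<not> disjoint_family_on ?C (insert y F)"
      proof
        assume "disjoint_family_on ?C (insert y F)"
        then have "card (insert y F) \<le> card F" using F y by (intro max) auto
        then show False using False F by simp
      qed
      then have "\<not> (?C y \<inter> (\<Union>x\<in>F. ?C x) = {})"
        using F False by (simp add: disjoint_family_on_insert)
      then obtain x z where x: "x \<in> F" and z: "z \<in> ?C y" "z \<in> ?C x" by auto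
      have "bowen_dist X T n x y < r"
        using z x F G ym assms(4)
        by (intro bowen_dist_triangle_less[OF n, where y = z and a = \<epsilon> and b = \<epsilon>])
           (auto simp: bowen_cball_def bowen_dist_commute[of X T n z])
      then show ?thesis using x ym by (auto simp: bowen_ball_def)
    qed
  qed
  with F that show thesis by blast
qed

end

section \<open>Measures of Bowen balls\<close>

locale nonautonomous_ds_prob = nonautonomous_ds X T + prob_space \<mu>
  for X :: "nat \<Rightarrow> 'a metric" and T :: "nat \<Rightarrow> 'a \<Rightarrow> 'a" and \<mu> :: "'a measure" +
  assumes sets_eq: "sets \<mu> = sets (metric_borel (X 0))"
begin

lemma space_eq: "space \<mu> = mspace (X 0)"
  using sets_eq_imp_space_eq[OF sets_eq] by (simp add: space_metric_borel)

lemma sets_bowen_ball: "n > 0 \<Longrightarrow> x \<in> mspace (X 0) \<Longrightarrow> bowen_ball X T n x \<epsilon> \<in> sets \<mu>"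
  unfolding sets_eq by (intro sets_metric_borelI openin_bowen_ball)

lemma local_entropy_at_scale_antimono:
  assumes x: "x \<in> mspace (X 0)" and "a \<le> b"
  shows "local_entropy_at_scale X T \<mu> x b \<le> local_entropy_at_scale X T \<mu> x a"
  unfolding local_entropy_at_scale_def
\<comment> \<open>Comparing the terms from \<open>n = 1\<close> on suffices, and
  \<open>sets_bowen_ball\<close> supplies measurability there.\<close>
proof (intro Limsup_mono eventually_sequentiallyI)
  fix n :: nat assume n: "1 \<le> n"
  have "measure \<mu> (bowen_ball X T n x a) \<le> measure \<mu> (bowen_ball X T n x b)"
    using assms n by (intro finite_measure_mono sets_bowen_ball) (auto simp: bowen_ball_def)
  then have "- log_ereal (measure \<mu> (bowen_ball X T n x b)) \<le> - log_ereal (measure \<mu> (bowen_ball X T n x a))"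
    by (simp add: log_ereal_mono)
  then show "- log_ereal (measure \<mu> (bowen_ball X T n x b)) / ereal (real n)
      \<le> - log_ereal (measure \<mu> (bowen_ball X T n x a)) / ereal (real n)"
    using n by (intro ereal_divide_right_mono) auto
qed

lemma upper_local_entropy_eq_SUP:
  assumes "x \<in> mspace (X 0)"
  shows "upper_local_entropy X T \<mu> x = (SUP \<epsilon>\<in>{0<..}. local_entropy_at_scale X T \<mu> x \<epsilon>)"
  using Lim_at_right_decreasing[of "local_entropy_at_scale X T \<mu> x"]
    local_entropy_at_scale_antimono[OF assms]
  by (simp add: upper_local_entropy_def local_entropy_at_scale_def[abs_def])

section \<open>Upper bound for the packing entropy\<close>

text \<open>Each weight splits as \<open>exp (- n * (u - t)) * exp (- n * t)\<close>. As
  \<open>n \<ge> N\<close>, the first factor is at most the claimed bound; the second is at most the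
  measure of a ball, and these measures sum to at most 1.\<close>

lemma packing_sum_le_of_ball_lower_bound:
  assumes W: "W \<subseteq> mspace (X 0)" and N: "N > 0" and "t \<le> u"
    and lower: "\<And>x n. x \<in> W \<Longrightarrow> n \<ge> N \<Longrightarrow> exp (- real n * t) \<le> measure \<mu> (bowen_ball X T n x \<epsilon>)"
  shows "packing_sum X T N \<epsilon> u W \<le> ennreal (exp (- real N * (u - t)))"
  unfolding packing_sum_def
proof (rule SUP_least)
  fix P assume "P \<in> {P. bowen_packing X T N \<epsilon> W P}"
  then have P: "P \<subseteq> W \<times> {N..}" "disjoint_family_on (\<lambda>(x, n). bowen_cball X T n x \<epsilon>) P"
    by (auto simp: bowen_packing_def)
  show "(\<Sum>\<^sub>\<infinity>(x, n)\<in>P. ennreal (exp (- real n * u))) \<le> ennreal (exp (- real N * (u - t)))"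
  \<comment> \<open>Finite subfamilies suffice, so only finite additivity of \<mu> enters.\<close>
  proof (rule infsum_le_finite_sums)
    fix F assume F: "finite F" "F \<subseteq> P"
    let ?B = "\<lambda>(x, n). bowen_ball X T n x \<epsilon>"
    \<comment> \<open>The open balls inherit disjointness from the closed balls containing
      them.\<close>
    have "disjoint_family_on ?B F"
      by (rule disjoint_family_on_shrink[OF P(2) F(2)])
         (auto simp: bowen_ball_def bowen_cball_def)
    moreover have "?B p \<in> sets \<mu>" if "p \<in> F" for p
      using that F P(1) W N by (auto intro!: sets_bowen_ball)
    ultimately have le1: "(\<Sum>p\<in>F. measure \<mu> (?B p)) \<le> 1"
      using F(1) by (subst finite_measure_finite_Union[symmetric]) (auto simp: image_subset_iff)
    have "exp (- real n * u) \<le> exp (- real N * (u - t)) * measure \<mu> (bowen_ball X T n x \<epsilon>)"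
      if "(x, n) \<in> F" for x n
    proof -
      have xn: "x \<in> W" "n \<ge> N" using that F P(1) by auto
      have "real N * (u - t) \<le> real n * (u - t)"
        using xn(2) \<open>t \<le> u\<close> by (intro mult_right_mono) auto
      then have "exp (- real n * u) \<le> exp (- real N * (u - t)) * exp (- real n * t)"
        by (simp add: algebra_simps flip: exp_add)
      also have "\<dots> \<le> exp (- real N * (u - t)) * measure \<mu> (bowen_ball X T n x \<epsilon>)"
        using lower[OF xn] by (intro mult_left_mono) auto
      finally show ?thesis .
    qed
    then have "(\<Sum>(x, n)\<in>F. exp (- real n * u)) \<le>
        (\<Sum>p\<in>F. exp (- real N * (u - t)) * measure \<mu> (?B p))"
      by (intro sum_mono) auto
    also have "\<dots> \<le> exp (- real N * (u - t)) * 1"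
      unfolding sum_distrib_left[symmetric] using le1 by (intro mult_left_mono) auto
    finally have "ennreal (\<Sum>(x, n)\<in>F. exp (- real n * u)) \<le> ennreal (exp (- real N * (u - t)))"
      by (intro ennreal_leI) simp
    then show "(\<Sum>(x, n)\<in>F. ennreal (exp (- real n * u))) \<le> ennreal (exp (- real N * (u - t)))"
      by (simp add: case_prod_unfold)
  qed (rule nonneg_summable_on_complete, simp)
qed

text \<open>The outer measure permits a countable decomposition of \<open>E\<close>; on each stratum
  \<open>W N\<close> the ball bound holds from a time common to all points.\<close>

lemma packing_outer_measure_eq_0:
  assumes E: "E \<subseteq> mspace (X 0)" and "t < u"
    and ent: "\<And>x. x \<in> E \<Longrightarrow> local_entropy_at_scale X T \<mu> x \<epsilon> < ereal t"
  shows "packing_outer_measure X T \<epsilon> u E = 0"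
proof -
  define W where "W N = {x \<in> E. \<forall>n\<ge>N. exp (- real n * t) < measure \<mu> (bowen_ball X T n x \<epsilon>)}" for N
  have "E \<subseteq> (\<Union>N. W N)"
  proof
    fix x assume x: "x \<in> E"
    have "eventually (\<lambda>n. - log_ereal (measure \<mu> (bowen_ball X T n x \<epsilon>)) / ereal (real n) < ereal t) sequentially"
      using ent[OF x] unfolding local_entropy_at_scale_def by (rule Limsup_lessD)
    then have "eventually (\<lambda>n. exp (- real n * t) < measure \<mu> (bowen_ball X T n x \<epsilon>)) sequentially"
      using eventually_gt_at_top[of 0] by eventually_elim (metis measure_nonneg neg_log_ereal_div_less_iff)
    then show "x \<in> (\<Union>N. W N)"
      using x by (auto simp: W_def eventually_sequentially)
  qed
  moreover have "packing_premeasure X T \<epsilon> u (W N) = 0" for N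
  proof -
    \<comment> \<open>\<open>Suc N\<close> ensures that \<open>M\<close> is positive even when
      \<open>N = 0\<close>.\<close>
    have le: "packing_premeasure X T \<epsilon> u (W N) \<le> ennreal (exp (- real M * (u - t)))" if "M \<ge> Suc N" for M
    proof -
      have "packing_premeasure X T \<epsilon> u (W N) \<le> packing_sum X T M \<epsilon> u (W N)"
        unfolding packing_premeasure_eq_INF by (intro INF_lower) simp
      also have "\<dots> \<le> ennreal (exp (- real M * (u - t)))"
        using that E \<open>t < u\<close>
        by (intro packing_sum_le_of_ball_lower_bound) (auto simp: W_def intro: less_imp_le)
      finally show ?thesis .
    qed
    have "(\<lambda>M. exp (- (u - t)) ^ M) \<longlonglongrightarrow> 0"
      using \<open>t < u\<close> by (intro LIMSEQ_power_zero) simp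
    then have "(\<lambda>M. exp (- real M * (u - t))) \<longlonglongrightarrow> 0"
      by (simp add: algebra_simps flip: exp_of_nat_mult)
    then have "(\<lambda>M. ennreal (exp (- real M * (u - t)))) \<longlonglongrightarrow> ennreal 0"
      by (rule tendsto_ennrealI)
    then have "packing_premeasure X T \<epsilon> u (W N) \<le> ennreal 0"
      using le by (intro LIMSEQ_le_const) auto
    then show ?thesis by simp
  qed
  ultimately have "packing_outer_measure X T \<epsilon> u E \<le> 0"
    unfolding packing_outer_measure_def using E
    by (intro INF_lower2[of W]) (auto simp: W_def)
  then show ?thesis by simp
qed

lemma packing_entropy_le:
  assumes E: "E \<subseteq> mspace (X 0)" and ent: "\<And>x. x \<in> E \<Longrightarrow> upper_local_entropy X T \<mu> x \<le> ereal s"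
  shows "packing_entropy X T E \<le> ereal s"
  unfolding packing_entropy_eq_SUP
proof (rule SUP_least)
  fix \<epsilon> :: real assume "\<epsilon> \<in> {0<..}"
  then have e: "\<epsilon> > 0" by simp
  show "packing_entropy_at_scale X T E \<epsilon> \<le> ereal s"
  proof (rule ereal_le_epsilon2)
    fix d :: real assume d: "0 < d"
    \<comment> \<open>Half of \<open>d\<close> makes the entropy bound strict; the other half
      separates \<open>t\<close> from the exponent \<open>s + d\<close>.\<close>
    have "local_entropy_at_scale X T \<mu> x \<epsilon> < ereal (s + d / 2)" if x: "x \<in> E" for x
    proof -
      have "local_entropy_at_scale X T \<mu> x \<epsilon> \<le> upper_local_entropy X T \<mu> x"
        using x E e by (subst upper_local_entropy_eq_SUP) (auto intro: SUP_upper)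
      also have "\<dots> \<le> ereal s" by (rule ent[OF x])
      finally show ?thesis using d by (auto intro: le_less_trans)
    qed
    then have "packing_outer_measure X T \<epsilon> (s + d) E = 0"
      using E d by (intro packing_outer_measure_eq_0[where t = "s + d / 2"]) auto
    then show "packing_entropy_at_scale X T E \<epsilon> \<le> ereal s + ereal d"
      unfolding packing_entropy_at_scale_def by (intro INF_lower2[of "s + d"]) auto
  qed
qed

section \<open>Lower bound for the packing entropy\<close>

text \<open>Centres of a maximal disjoint family, all taken with the same time \<open>n\<close>,
  form an admissible packing. Their \<open>r\<close>-balls cover \<open>G\<close>, and each has
  measure at most its packing weight times \<open>exp (- n * (t - u))\<close>.\<close>

lemma outer_measure_le_packing_sum:
  assumes n: "n > 0" "n \<ge> N" and e: "\<epsilon> > 0" "2 * \<epsilon> < r" and G: "G \<subseteq> mspace (X 0)"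
    and upper: "\<And>x. x \<in> G \<Longrightarrow> measure \<mu> (bowen_ball X T n x r) \<le> exp (- real n * t)"
  shows "outer_measure_of \<mu> G \<le> packing_sum X T N \<epsilon> u G * ennreal (exp (- real n * (t - u)))"
proof -
  obtain F where F: "finite F" "F \<subseteq> G" "disjoint_family_on (\<lambda>x. bowen_cball X T n x \<epsilon>) F"
      "G \<subseteq> (\<Union>x\<in>F. bowen_ball X T n x r)"
    using finite_maximal_disjoint_bowen_cballs[OF n(1) e(1) G e(2)] by metis
  let ?P = "(\<lambda>x. (x, n)) ` F"
  have meas: "bowen_ball X T n x r \<in> sets \<mu>" if "x \<in> F" for x
    using that F(2) G n by (intro sets_bowen_ball) auto
  have "bowen_packing X T N \<epsilon> G ?P"
    using F(1-3) n by (auto simp: bowen_packing_def disjoint_family_on_def countable_finite)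
  then have "(\<Sum>\<^sub>\<infinity>(x, k)\<in>?P. ennreal (exp (- real k * u))) \<le> packing_sum X T N \<epsilon> u G"
    unfolding packing_sum_def by (intro SUP_upper) simp
  moreover have "(\<Sum>\<^sub>\<infinity>(x, k)\<in>?P. ennreal (exp (- real k * u))) = (\<Sum>x\<in>F. ennreal (exp (- real n * u)))"
    using F(1) by (subst infsum_finite) (auto simp: sum.reindex inj_on_def)
  ultimately have le: "(\<Sum>x\<in>F. ennreal (exp (- real n * u))) \<le> packing_sum X T N \<epsilon> u G"
    by simp
  have "outer_measure_of \<mu> G \<le> outer_measure_of \<mu> (\<Union>x\<in>F. bowen_ball X T n x r)"
    by (intro outer_measure_of_mono F)
  also have "\<dots> = emeasure \<mu> (\<Union>x\<in>F. bowen_ball X T n x r)"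
    using F(1) meas by (intro outer_measure_of_eq) auto
  also have "\<dots> \<le> (\<Sum>x\<in>F. emeasure \<mu> (bowen_ball X T n x r))"
    using F(1) meas by (intro emeasure_subadditive_finite) auto
  also have "\<dots> \<le> (\<Sum>x\<in>F. ennreal (exp (- real n * u)) * ennreal (exp (- real n * (t - u))))"
  proof (rule sum_mono)
    fix x assume "x \<in> F"
    then have "emeasure \<mu> (bowen_ball X T n x r) \<le> ennreal (exp (- real n * t))"
      unfolding emeasure_eq_measure using F(2) by (intro ennreal_leI upper) auto
    also have "exp (- real n * t) = exp (- real n * u) * exp (- real n * (t - u))"
      by (simp add: algebra_simps flip: exp_add)
    finally show "emeasure \<mu> (bowen_ball X T n x r)
        \<le> ennreal (exp (- real n * u)) * ennreal (exp (- real n * (t - u)))"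
      by (simp add: ennreal_mult)
  qed
  also have "\<dots> \<le> packing_sum X T N \<epsilon> u G * ennreal (exp (- real n * (t - u)))"
    unfolding sum_distrib_right[symmetric] by (intro mult_right_mono le) simp
  finally show ?thesis .
qed

text \<open>For every \<open>N\<close> the sets \<open>G n\<close> with \<open>n \<ge> N\<close>
  cover \<open>A\<close>. Bounding by the full series makes the constant independent of
  \<open>N\<close>, which can then tend to infinity.\<close>

lemma outer_measure_le_packing_premeasure:
  assumes e: "\<epsilon> > 0" "2 * \<epsilon> < r" and A: "A \<subseteq> mspace (X 0)" and "u < t"
    and ent: "\<And>x. x \<in> A \<Longrightarrow> ereal t < local_entropy_at_scale X T \<mu> x r"
  shows "outer_measure_of \<mu> A \<le> packing_premeasure X T \<epsilon> u A * (\<Sum>n. ennreal (exp (- real n * (t - u))))"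
proof -
  let ?C = "\<Sum>n. ennreal (exp (- real n * (t - u)))"
  have le: "outer_measure_of \<mu> A \<le> packing_sum X T N \<epsilon> u A * ?C" for N
  proof -
    define G where "G n = {x \<in> A. n > 0 \<and> n \<ge> N \<and> measure \<mu> (bowen_ball X T n x r) < exp (- real n * t)}" for n
    have "A \<subseteq> (\<Union>n. G n)"
    proof
      fix x assume x: "x \<in> A"
      \<comment> \<open>A limsup above \<open>t\<close> forces terms above \<open>t\<close> at
        arbitrarily late times; starting at \<open>Suc N\<close> also excludes
        \<open>n = 0\<close>.\<close>
      obtain n where "n \<ge> Suc N" "ereal t < - log_ereal (measure \<mu> (bowen_ball X T n x r)) / ereal (real n)"
      proof (rule ccontr)
        assume "\<not> thesis"
        with that have "local_entropy_at_scale X T \<mu> x r \<le> ereal t"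
          unfolding local_entropy_at_scale_def
          by (intro Limsup_bounded eventually_sequentiallyI[of "Suc N"]) (meson not_less)
        with ent[OF x] show False by simp
      qed
      then have "x \<in> G n"
        using x less_neg_log_ereal_div_iff[of "measure \<mu> (bowen_ball X T n x r)" n t]
        by (simp add: G_def del: ereal_uminus_divide)
      then show "x \<in> (\<Union>n. G n)" by blast
    qed
    then have "outer_measure_of \<mu> A \<le> outer_measure_of \<mu> (\<Union>n. G n)"
      by (rule outer_measure_of_mono)
    also have "\<dots> \<le> (\<Sum>n. outer_measure_of \<mu> (G n))"
      using A by (intro outer_measure_of_UN_le) (auto simp: G_def space_eq)
    also have "\<dots> \<le> (\<Sum>n. packing_sum X T N \<epsilon> u A * ennreal (exp (- real n * (t - u))))"
    proof (intro suminf_le)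
      fix n
      show "outer_measure_of \<mu> (G n) \<le> packing_sum X T N \<epsilon> u A * ennreal (exp (- real n * (t - u)))"
      proof (cases "n > 0 \<and> n \<ge> N")
        case True
        then have "outer_measure_of \<mu> (G n) \<le> packing_sum X T N \<epsilon> u (G n) * ennreal (exp (- real n * (t - u)))"
          using A by (intro outer_measure_le_packing_sum[OF _ _ e]) (auto simp: G_def)
        also have "\<dots> \<le> packing_sum X T N \<epsilon> u A * ennreal (exp (- real n * (t - u)))"
          by (intro mult_right_mono packing_sum_mono_set) (auto simp: G_def)
        finally show ?thesis .
      next
        case False
        then have "G n = {}" by (auto simp: G_def)
        then show ?thesis by simp
      qed
    qed auto
    finally show ?thesis by simp
  qed
  have "(\<lambda>N. packing_sum X T N \<epsilon> u A) \<longlonglongrightarrow> packing_premeasure X T \<epsilon> u A"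
    unfolding packing_premeasure_eq_INF by (intro LIMSEQ_INF decseq_packing_sum)
  \<comment> \<open>Finiteness of \<open>?C\<close> lets the limit pass through the product in
    \<open>ennreal\<close>.\<close>
  then have "(\<lambda>N. packing_sum X T N \<epsilon> u A * ?C) \<longlonglongrightarrow> packing_premeasure X T \<epsilon> u A * ?C"
    unfolding mult.commute[of _ ?C] by (rule ennreal_tendsto_cmult[OF suminf_exp_less_top[OF \<open>u < t\<close>]])
  then show ?thesis
    using le by (intro LIMSEQ_le_const) auto
qed

text \<open>For any cover \<open>W\<close> of \<open>E\<close>, the premeasure estimate applies to
  each \<open>W i \<inter> A\<close>, whose points keep the entropy bound. Summation gives a
  positive lower bound independent of the cover.\<close>

lemma packing_outer_measure_pos:
  assumes e: "\<epsilon> > 0" "2 * \<epsilon> < r" and A: "A \<subseteq> E" "E \<subseteq> mspace (X 0)" and "u < t"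
    and ent: "\<And>x. x \<in> A \<Longrightarrow> ereal t < local_entropy_at_scale X T \<mu> x r"
    and pos: "outer_measure_of \<mu> A > 0"
  shows "packing_outer_measure X T \<epsilon> u E > 0"
proof -
  define C where "C = (\<Sum>n. ennreal (exp (- real n * (t - u))))"
  have "outer_measure_of \<mu> A / C \<le> packing_outer_measure X T \<epsilon> u E"
    unfolding packing_outer_measure_def
  proof (rule INF_greatest)
    fix W :: "nat \<Rightarrow> 'a set" assume "W \<in> {W. (\<forall>i. W i \<subseteq> mspace (X 0)) \<and> E \<subseteq> (\<Union>i. W i)}"
    then have W: "E \<subseteq> (\<Union>i. W i)" by simp
    have "outer_measure_of \<mu> A \<le> outer_measure_of \<mu> (\<Union>i. W i \<inter> A)"
      using W A by (intro outer_measure_of_mono) auto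
    also have "\<dots> \<le> (\<Sum>i. outer_measure_of \<mu> (W i \<inter> A))"
      using A by (intro outer_measure_of_UN_le) (auto simp: space_eq)
    also have "\<dots> \<le> (\<Sum>i. C * packing_premeasure X T \<epsilon> u (W i))"
    proof (intro suminf_le)
      fix i
      have "outer_measure_of \<mu> (W i \<inter> A) \<le> packing_premeasure X T \<epsilon> u (W i \<inter> A) * C"
        unfolding C_def using A ent by (intro outer_measure_le_packing_premeasure[OF e _ \<open>u < t\<close>]) auto
      also have "\<dots> \<le> packing_premeasure X T \<epsilon> u (W i) * C"
        unfolding packing_premeasure_eq_INF
        by (intro mult_right_mono INF_mono' packing_sum_mono_set) auto
      finally show "outer_measure_of \<mu> (W i \<inter> A) \<le> C * packing_premeasure X T \<epsilon> u (W i)"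
        by (simp add: mult.commute)
    qed auto
    finally have le: "outer_measure_of \<mu> A \<le> C * (\<Sum>i. packing_premeasure X T \<epsilon> u (W i))"
      by simp
    then have "C \<noteq> 0" using pos by auto
    then have "C > 0" by (simp add: zero_less_iff_neq_zero)
    then show "outer_measure_of \<mu> A / C \<le> (\<Sum>i. packing_premeasure X T \<epsilon> u (W i))"
      using le by (intro divide_le_posI_ennreal) (auto simp: mult.commute)
  qed
  \<comment> \<open>The quotient is positive because \<open>C\<close> is finite.\<close>
  moreover have "outer_measure_of \<mu> A / C > 0"
    using pos suminf_exp_less_top[OF \<open>u < t\<close>] by (simp add: C_def ennreal_zero_less_divide)
  ultimately show ?thesis by simp
qed

text \<open>The scale at which the local entropy exceeds \<open>t\<close> depends on the point.
  Countably many scales suffice by monotonicity, and subadditivity yields one that serves a subset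
  of positive outer measure.\<close>

lemma packing_entropy_ge:
  assumes E: "E \<in> sets \<mu>" and pos: "measure \<mu> E > 0"
    and ent: "\<And>x. x \<in> E \<Longrightarrow> ereal s \<le> upper_local_entropy X T \<mu> x"
  shows "ereal s \<le> packing_entropy X T E"
proof (rule ereal_le_epsilon2)
  fix d :: real assume d: "0 < d"
  define t where "t = s - d"
  have Esub: "E \<subseteq> mspace (X 0)"
    using sets.sets_into_space[OF E] by (simp add: space_eq)
  define r where "r k = inverse (real (Suc k))" for k
  define A where "A k = {x \<in> E. ereal t < local_entropy_at_scale X T \<mu> x (r k)}" for k
  have "E \<subseteq> (\<Union>k. A k)"
  proof
    fix x assume x: "x \<in> E"
    then have "x \<in> mspace (X 0)" using Esub by auto
    have "ereal t < ereal s" using d by (simp add: t_def)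
    also have "\<dots> \<le> upper_local_entropy X T \<mu> x" by (rule ent[OF x])
    finally obtain \<epsilon> where "\<epsilon> > 0" and less: "ereal t < local_entropy_at_scale X T \<mu> x \<epsilon>"
      using upper_local_entropy_eq_SUP[OF \<open>x \<in> mspace (X 0)\<close>] by (auto simp: less_SUP_iff)
    from \<open>\<epsilon> > 0\<close> obtain k where "r k < \<epsilon>"
      unfolding r_def using reals_Archimedean by blast
    then have "ereal t < local_entropy_at_scale X T \<mu> x (r k)"
      using less local_entropy_at_scale_antimono[OF \<open>x \<in> mspace (X 0)\<close>, of "r k" \<epsilon>] by simp
    with x show "x \<in> (\<Union>k. A k)" by (auto simp: A_def)
  qed
  have "0 < outer_measure_of \<mu> E"
    using E pos by (simp add: emeasure_eq_measure)
  also have "\<dots> \<le> outer_measure_of \<mu> (\<Union>k. A k)"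
    by (rule outer_measure_of_mono) fact
  also have "\<dots> \<le> (\<Sum>k. outer_measure_of \<mu> (A k))"
    using Esub by (intro outer_measure_of_UN_le) (auto simp: A_def space_eq)
  finally have "(\<Sum>k. outer_measure_of \<mu> (A k)) \<noteq> 0" by simp
  then have "\<exists>k. outer_measure_of \<mu> (A k) \<noteq> 0"
    by (rule contrapos_np) simp
  then obtain k where k: "outer_measure_of \<mu> (A k) > 0"
    by (auto simp: zero_less_iff_neq_zero)
  have r: "r k > 0" by (simp add: r_def)
  \<comment> \<open>The divisor 3 gives \<open>2 * (r k / 3) < r k\<close>, as the covering argument
    requires.\<close>
  have "ereal t \<le> packing_entropy_at_scale X T E (r k / 3)"
    unfolding packing_entropy_at_scale_def
  proof (rule INF_greatest)
    fix u :: real assume u: "u \<in> {u. packing_outer_measure X T (r k / 3) u E = 0}"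
    have "packing_outer_measure X T (r k / 3) u E > 0" if "u < t"
      using r that k Esub
      by (intro packing_outer_measure_pos[where r = "r k" and A = "A k" and t = t]) (auto simp: A_def)
    with u show "ereal t \<le> ereal u" by force
  qed
  also have "\<dots> \<le> packing_entropy X T E"
    unfolding packing_entropy_eq_SUP using r by (intro SUP_upper) auto
  finally have "ereal t + ereal d \<le> packing_entropy X T E + ereal d"
    by (rule add_right_mono)
  then show "ereal s \<le> packing_entropy X T E + ereal d"
    by (simp add: t_def)
qed

end

theorem corollary2p10:
  fixes X :: "nat \<Rightarrow> 'a metric" and T :: "nat \<Rightarrow> 'a \<Rightarrow> 'a"
    and E :: "'a set" and s :: real and \<mu> :: "'a measure"
  assumes "nonautonomous_ds X T"
    and "E \<in> sets (metric_borel (X 0))"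
    and "s > 0"
    and "prob_space \<mu>"
    and "sets \<mu> = sets (metric_borel (X 0))"
  shows "((\<forall>x\<in>E. upper_local_entropy X T \<mu> x \<le> ereal s) \<longrightarrow> packing_entropy X T E \<le> ereal s) \<and>
         ((\<forall>x\<in>E. upper_local_entropy X T \<mu> x \<ge> ereal s) \<and> measure \<mu> E > 0
            \<longrightarrow> packing_entropy X T E \<ge> ereal s)"
proof -
  interpret nonautonomous_ds_prob X T \<mu>
    using assms by (simp add: nonautonomous_ds_prob_def nonautonomous_ds_prob_axioms_def)
  have E: "E \<in> sets \<mu>" using assms by simp
  then have "E \<subseteq> mspace (X 0)"
    using sets.sets_into_space[OF E] by (simp add: space_eq)
  then show ?thesis
    using packing_entropy_le[of E s] packing_entropy_ge[OF E, of s] by blast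
qed

end
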